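(* There exist a compact metric space $X$ and a distal homeomorphism $f:X\to X$ that does not satisfy property (CW).
   Context: Let $(X,d)$ be a compact metric space and $f:X\to X$ a homeomorphism; $f^n$ denotes the $n$-th iterate for $n\in\mathbb{Z}$. $f$ is distal if $\inf_{n\in\mathbb{Z}}d(f^n(x),f^n(y))>0$ for all distinct points $x,y\in X$. For $p\in X$ and nonempty $B\subset X$, $dist(p,B)=\inf\{d(p,b):b\in B\}$. A subcontinuum of $X$ is a nonempty compact connected subset of $X$. $f$ satisfies property (CW) if $\inf_{n\in\mathbb{Z}}dist(f^n(x),f^n(C))>0$ for every $x\in X$ and every subcontinuum $C$ of $X$ with $x\notin C$. *)

theory Defs
  imports "HOL-Analysis.Analysis"
begin

text \<open>
  The iterate \<open>f\<^sup>n\<close> for integer \<open>n\<close> of a bijection \<open>f\<close> of the set \<open>M\<close> onto itself; only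
  its values on \<open>M\<close> are meaningful.
\<close>

definition int_iterate :: "'a set \<Rightarrow> ('a \<Rightarrow> 'a) \<Rightarrow> int \<Rightarrow> 'a \<Rightarrow> 'a" where
  "int_iterate M f n =
     (if 0 \<le> n then f ^^ nat n else inv_into M f ^^ nat (- n))"

context Metric_space
begin

definition distal :: "('a \<Rightarrow> 'a) \<Rightarrow> bool" where
  "distal f \<longleftrightarrow>
     (\<forall>x\<in>M. \<forall>y\<in>M. x \<noteq> y \<longrightarrow>
        (INF n. d (int_iterate M f n x) (int_iterate M f n y)) > 0)"

definition dist_to_set :: "'a \<Rightarrow> 'a set \<Rightarrow> real" where
  "dist_to_set p B = (INF b\<in>B. d p b)"

definition subcontinuum :: "'a set \<Rightarrow> bool" where
  "subcontinuum C \<longleftrightarrow> C \<noteq> {} \<and> compactin mtopology C \<and> connectedin mtopology C"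

definition property_CW :: "('a \<Rightarrow> 'a) \<Rightarrow> bool" where
  "property_CW f \<longleftrightarrow>
     (\<forall>x\<in>M. \<forall>C. subcontinuum C \<and> x \<notin> C \<longrightarrow>
        (INF n. dist_to_set (int_iterate M f n x) (int_iterate M f n ` C)) > 0)"

end

text \<open>
  HOL has no existential quantifier over types, so a claim that some compact metric space
  exists must name a type from which the points are drawn. A compact metric space has at most
  continuum many points, so it is isometric to one whose points form a subset of the type
  \<^typ>\<open>complex\<close>, the metric being transported along an injection. Quantifying over all subsets
  of \<^typ>\<open>complex\<close> and all metrics on them, not just the Euclidean one, is therefore no
  restriction.
\<close>

end

theory Submission
  imports Defs
begin

text \<open>
  Twist the annulus \<open>1 \<le> \<bar>z\<bar> \<le> 2\<close> by rotating each circle \<open>\<bar>z\<bar> = r\<close> by the angle \<open>r\<close>. Points on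
  the same circle keep their distance, and points on different circles stay at least as far apart
  as the radii, so the twist is distal. The \<open>n\<close>-th iterate winds the segment \<open>[1, 2]\<close> into a
  spiral whose consecutive turns are \<open>2\<pi>/n\<close> apart, so it comes within \<open>\<pi>/n\<close> of the iterate
  of \<open>-1\<close>.
\<close>

definition annulus :: "complex set" where
  "annulus = {z. 1 \<le> norm z \<and> norm z \<le> 2}"

text \<open>The angle carries a factor \<open>a\<close> because the maps then form a one-parameter
  group: iterates and the inverse of \<open>twist 1\<close> are again twists, and
  \<open>int_iterate\<close> gets a closed form.\<close>

definition twist :: "real \<Rightarrow> complex \<Rightarrow> complex" where
  "twist a z = z * cis (a * norm z)"

lemma norm_twist [simp]: "norm (twist a z) = norm z"
  by (simp add: twist_def norm_mult)

lemma twist_0 [simp]: "twist 0 z = z"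
  by (simp add: twist_def)

lemma twist_twist [simp]: "twist a (twist b z) = twist (a + b) z"
  by (simp add: twist_def norm_mult mult.assoc cis_mult distrib_right add.commute)

lemma twist_in_annulus_iff [simp]: "twist a z \<in> annulus \<longleftrightarrow> z \<in> annulus"
  by (simp add: annulus_def)

lemma continuous_on_twist: "continuous_on A (twist a)"
  unfolding twist_def by (intro continuous_intros)

lemma funpow_twist: "twist a ^^ n = twist (of_nat n * a)"
  by (induction n) (auto simp: fun_eq_iff algebra_simps)

lemma inj_twist: "inj (twist a)"
  by (rule inj_on_inverseI [of _ "twist (- a)"]) simp

lemma inv_into_twist:
  assumes "z \<in> annulus"
  shows "inv_into annulus (twist a) z = twist (- a) z"
  using assms inj_on_subset [OF inj_twist] by (intro inv_into_f_eq) auto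

text \<open>\<open>inv_into annulus\<close> agrees with \<open>twist (- a)\<close> on the annulus;
  twists preserve the annulus, so each step of the induction stays where this holds.\<close>

lemma funpow_inv_into_twist:
  assumes "z \<in> annulus"
  shows "(inv_into annulus (twist a) ^^ n) z = twist (- (of_nat n * a)) z"
  using assms by (induction n) (auto simp: inv_into_twist algebra_simps)

lemma int_iterate_twist:
  assumes "z \<in> annulus"
  shows "int_iterate annulus (twist 1) n z = twist (of_int n) z"
  using assms by (simp add: int_iterate_def funpow_twist funpow_inv_into_twist)

text \<open>Both points are multiplied by the same unit number
  \<open>cis (a * norm w)\<close>.\<close>

lemma dist_twist_same_norm:
  assumes "norm z = norm w"
  shows "dist (twist a z) (twist a w) = dist z w"
proof -
  have "twist a z - twist a w = (z - w) * cis (a * norm w)"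
    by (simp add: twist_def assms left_diff_distrib)
  then show ?thesis
    by (simp add: dist_norm norm_mult)
qed

text \<open>The bound \<open>e\<close> must not depend on \<open>a\<close>, since distality takes an
  infimum over all iterates. Off a common circle it comes from the reverse triangle inequality, as
  twists preserve norms.\<close>

lemma twist_uniformly_separated:
  assumes "z \<noteq> w"
  obtains e where "e > 0" "\<And>a. e \<le> dist (twist a z) (twist a w)"
proof (cases "norm z = norm w")
  case True
  show thesis
    by (rule that [of "dist z w"]) (use assms True in \<open>auto simp: dist_twist_same_norm\<close>)
next
  case False
  have "\<bar>norm z - norm w\<bar> \<le> dist (twist a z) (twist a w)" for a
    using norm_triangle_ineq3 [of "twist a z" "twist a w"] by (simp add: dist_norm)
  with False show thesis
    by (intro that [of "\<bar>norm z - norm w\<bar>"]) auto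
qed

text \<open>The point at radius \<open>1 + pi / n\<close> turns by \<open>n + pi\<close>, so it
  lands on the ray through \<open>- cis n\<close>, where \<open>- 1\<close> is sent. Only the
  difference of the radii remains.\<close>

lemma dist_twist_spiral:
  assumes "n > 0"
  shows "dist (twist n (- 1)) (twist n (of_real (1 + pi / n))) = pi / n"
proof -
  have "1 + pi / n > 0"
    using assms by (simp add: add_pos_pos)
  then have "norm (complex_of_real (1 + pi / n)) = 1 + pi / n"
    by (simp only: norm_of_real abs_of_pos)
  moreover have "n * (1 + pi / n) = n + pi"
    using assms by (simp add: field_simps)
  moreover have "cis (n + pi) = - cis n"
    by (simp add: minus_cis)
  ultimately have "twist n (of_real (1 + pi / n)) = - (of_real (1 + pi / n) * cis n)"
    by (simp add: twist_def del: of_real_add)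
  then have "twist n (- 1) - twist n (of_real (1 + pi / n)) = of_real (pi / n) * cis n"
    by (simp add: twist_def algebra_simps)
  then show ?thesis
    using assms by (simp add: dist_norm norm_mult norm_divide)
qed

lemma Metric_space_dist: "Metric_space A dist"
  using Met_TC.Metric_space_axioms Met_TC.subspace by blast

text \<open>Reduces compactness, connectedness and continuity for the abstract metric space to facts
  about subsets of the plane.\<close>

lemma mtopology_dist: "Metric_space.mtopology A dist = top_of_set A"
proof -
  interpret Submetric UNIV dist A
    by unfold_locales simp
  show ?thesis
    using mtopology_submetric by (simp add: mtopology_is_euclidean)
qed

lemma compact_annulus: "compact annulus"
proof -
  have "annulus = cball 0 2 - ball 0 1"
    by (auto simp: annulus_def)
  then show ?thesis
    by (metis compact_cball compact_diff open_ball)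
qed

lemma homeomorphic_map_twist:
  "homeomorphic_map (top_of_set annulus) (top_of_set annulus) (twist a)"
proof (rule homeomorphic_maps_imp_map)
  show "homeomorphic_maps (top_of_set annulus) (top_of_set annulus) (twist a) (twist (- a))"
    by (auto simp: homeomorphic_maps_def continuous_on_twist)
qed

lemma distal_twist: "Metric_space.distal annulus dist (twist 1)"
proof -
  interpret Metric_space annulus dist
    by (rule Metric_space_dist)
  show ?thesis
    unfolding distal_def
  proof (intro ballI impI)
    fix z w assume zw: "z \<in> annulus" "w \<in> annulus" "z \<noteq> w"
    obtain e where e: "e > 0" "\<And>a. e \<le> dist (twist a z) (twist a w)"
      using twist_uniformly_separated [OF zw(3)] by blast
    have "e \<le> (INF n. dist (twist (real_of_int n) z) (twist (real_of_int n) w))"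
      by (rule cINF_greatest) (use e in auto)
    with e zw show "(INF n. dist (int_iterate annulus (twist 1) n z)
                      (int_iterate annulus (twist 1) n w)) > 0"
      by (simp add: int_iterate_twist)
  qed
qed

lemma not_property_CW_twist: "\<not> Metric_space.property_CW annulus dist (twist 1)"
proof -
  interpret Metric_space annulus dist
    by (rule Metric_space_dist)
  define C where "C = complex_of_real ` {1..2}"
  define D where "D n = dist_to_set (int_iterate annulus (twist 1) n (- 1))
                          (int_iterate annulus (twist 1) n ` C)" for n
  have C_annulus: "C \<subseteq> annulus"
    by (auto simp: C_def annulus_def)
  have "compact C" "connected C"
    unfolding C_def
    by (intro compact_continuous_image connected_continuous_image continuous_intros; simp)+
  with C_annulus have C: "subcontinuum C"
    by (auto simp: subcontinuum_def mtopology_dist compactin_subtopology connectedin_subtopology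
        C_def)
  have mem: "- 1 \<in> annulus"
    by (simp add: annulus_def)
  have notin: "- 1 \<notin> C"
  proof
    assume "- 1 \<in> C"
    then obtain r where "r \<in> {1..2}" "- 1 = complex_of_real r"
      unfolding C_def by blast
    then have "Re (- 1) = r"
      by simp
    with \<open>r \<in> {1..2}\<close> show False
      by simp
  qed
  \<comment> \<open>This supplies the lower bound without which a real infimum need not lie below
    its members.\<close>
  have D_nonneg: "0 \<le> D n" for n
    unfolding D_def dist_to_set_def by (rule cINF_greatest) (auto simp: C_def)
  have D_le: "D (int n) \<le> pi / n" if "4 \<le> n" for n
  proof -
    \<comment> \<open>Since pi < 4 \<le> n, the radius \<open>1 + pi / n\<close> does not exceed 2
      and the point lies on the segment.\<close>
    have "pi / n \<le> 1"
      using that pi_less_4 by (simp add: field_simps)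
    then have r: "of_real (1 + pi / n) \<in> C"
      unfolding C_def by (intro imageI) auto
    have "D (int n) \<le> dist (int_iterate annulus (twist 1) (int n) (- 1))
                        (int_iterate annulus (twist 1) (int n) (of_real (1 + pi / n)))"
      unfolding D_def dist_to_set_def
      by (rule cINF_lower) (use r in \<open>auto intro!: bdd_belowI2 [of _ 0]\<close>)
    also have "\<dots> = dist (twist n (- 1)) (twist n (of_real (1 + pi / n)))"
      using mem r C_annulus by (subst (1 2) int_iterate_twist) auto
    also have "\<dots> = pi / n"
      using that by (intro dist_twist_spiral) auto
    finally show ?thesis .
  qed
  have bdd: "bdd_below (range D)"
    using D_nonneg by (rule bdd_belowI2)
  \<comment> \<open>The infimum runs over all integers, but the positive ones suffice: it is below
    \<open>pi / n\<close> for large \<open>n\<close>, hence below the limit 0.\<close>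
  have "(INF n. D n) \<le> 0"
  proof (rule tendsto_lowerbound)
    show "(\<lambda>n. pi / real n) \<longlonglongrightarrow> 0"
      by (rule lim_const_over_n)
    show "\<forall>\<^sub>F n in sequentially. (INF n. D n) \<le> pi / real n"
      using eventually_ge_at_top [of 4]
      by eventually_elim (meson D_le UNIV_I bdd cINF_lower order_trans)
  qed simp
  then have "\<not> (INF n. D n) > 0"
    by simp
  with C mem notin show ?thesis
    unfolding property_CW_def D_def by blast
qed

theorem corollary1p3:
  "\<exists>(X :: complex set) (d :: complex \<Rightarrow> complex \<Rightarrow> real) (f :: complex \<Rightarrow> complex).
     Metric_space X d \<and>
     compact_space (Metric_space.mtopology X d) \<and>
     homeomorphic_map (Metric_space.mtopology X d) (Metric_space.mtopology X d) f \<and>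
     Metric_space.distal X d f \<and>
     \<not> Metric_space.property_CW X d f"
proof (intro exI conjI)
  show "Metric_space annulus dist"
    by (rule Metric_space_dist)
  show "compact_space (Metric_space.mtopology annulus dist)"
    using compact_annulus by (simp add: mtopology_dist compact_space_subtopology)
  show "homeomorphic_map (Metric_space.mtopology annulus dist) (Metric_space.mtopology annulus dist)
          (twist 1)"
    by (simp add: mtopology_dist homeomorphic_map_twist)
qed (rule distal_twist not_property_CW_twist)+

end
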